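(* Let $a\ge 0$, $0\le\alpha\le\beta$ be real numbers and let $n\ge 1$ be an integer. If $f\in C[0,\infty)$, $x\in[0,\infty)$ and $\omega(f;\delta)$ is the modulus of continuity of $f$, then $$\left|L_{n,a}^{\alpha,\beta}(f;x)-f(x)\right|\le\left\{1+\sqrt{\gamma_{n,a}^{\alpha,\beta}(x)}\right\}\omega(f;\delta_{n,\beta}),$$ where $\delta_{n,\beta}=(n+\beta)^{-1/2}$ and $$\gamma_{n,a}^{\alpha,\beta}(x)=\frac{n+\beta^2}{n+\beta}x^2+\frac{n-2\alpha\beta}{n+\beta}x+\frac{a^2}{n+\beta}\frac{x^2}{(1+x)^2}-\frac{2a\beta}{n+\beta}\frac{x^2}{1+x}+\frac{a(1+2\alpha)}{n+\beta}\frac{x}{1+x}+\frac{\alpha^2}{n+\beta}.$$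
   Context: $C[0,\infty)$ is the set of continuous real-valued functions on $[0,\infty)$. For an integer $n\ge1$, reals $a\ge0$, $x\ge 0$, and an integer $k\ge0$, put $$W_{n,k}^a(x)=e^{-\frac{ax}{1+x}}\,\frac{p_k(n,a)}{k!}\,\frac{x^k}{(1+x)^{k+n}},\qquad p_k(n,a)=\sum_{i=0}^{k}\binom{k}{i}(n)_i\,a^{k-i},$$ where $(n)_0=1$, $(n)_i=n(n+1)\cdots(n+i-1)$, and $0^0=1$; then $\sum_{k=0}^\infty W_{n,k}^a(x)=1$. The Stancu-variant of the generalized Baskakov operators is $$L_{n,a}^{\alpha,\beta}(f;x)=\sum_{k=0}^{\infty}W_{n,k}^a(x)\,f\left(\frac{k+\alpha}{n+\beta}\right).$$ The modulus of continuity is $\omega(f;\delta)=\sup\{|f(s)-f(t)|: s,t\in[0,\infty),\ |s-t|\le\delta\}\in[0,\infty]$; the inequality is understood to be vacuous when $\omega(f;\delta_{n,\beta})=\infty$. *)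

theory Defs
  imports Complex_Main "HOL-Library.Extended_Real"
begin

definition baskakov_p :: "nat \<Rightarrow> nat \<Rightarrow> real \<Rightarrow> real" where
  "baskakov_p k n a = (\<Sum>i=0..k. real (k choose i) * pochhammer (real n) i * a ^ (k - i))"

definition baskakov_W :: "nat \<Rightarrow> nat \<Rightarrow> real \<Rightarrow> real \<Rightarrow> real" where
  "baskakov_W n k a x =
     exp (- (a * x / (1 + x))) * (baskakov_p k n a / fact k) * (x ^ k / (1 + x) ^ (k + n))"

text \<open>
  The series need not converge for every continuous \<open>f\<close>, and then \<open>suminf\<close> returns an
  unspecified real. It converges absolutely whenever some modulus of continuity \<open>\<omega>(f; \<delta>)\<close>,
  \<open>\<delta> > 0\<close>, is finite, since \<open>f\<close> then grows at most linearly.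
\<close>

definition stancu_baskakov ::
    "nat \<Rightarrow> real \<Rightarrow> real \<Rightarrow> real \<Rightarrow> (real \<Rightarrow> real) \<Rightarrow> real \<Rightarrow> real" where
  "stancu_baskakov n a \<alpha> \<beta> f x =
     (\<Sum>k. baskakov_W n k a x * f ((real k + \<alpha>) / (real n + \<beta>)))"

text \<open>The modulus of continuity on the half-line \<open>[0, \<infinity>)\<close>; it may be \<open>\<infinity>\<close>.\<close>

definition modulus_of_continuity :: "(real \<Rightarrow> real) \<Rightarrow> real \<Rightarrow> ereal" where
  "modulus_of_continuity f \<delta> =
     Sup {ereal \<bar>f s - f t\<bar> | s t. 0 \<le> s \<and> 0 \<le> t \<and> \<bar>s - t\<bar> \<le> \<delta>}"

definition stancu_delta :: "nat \<Rightarrow> real \<Rightarrow> real" where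
  "stancu_delta n \<beta> = (real n + \<beta>) powr (- 1 / 2)"

definition stancu_gamma :: "nat \<Rightarrow> real \<Rightarrow> real \<Rightarrow> real \<Rightarrow> real \<Rightarrow> real" where
  "stancu_gamma n a \<alpha> \<beta> x =
     (real n + \<beta>\<^sup>2) / (real n + \<beta>) * x\<^sup>2
     + (real n - 2 * \<alpha> * \<beta>) / (real n + \<beta>) * x
     + a\<^sup>2 / (real n + \<beta>) * (x\<^sup>2 / (1 + x)\<^sup>2)
     - 2 * a * \<beta> / (real n + \<beta>) * (x\<^sup>2 / (1 + x))
     + a * (1 + 2 * \<alpha>) / (real n + \<beta>) * (x / (1 + x))
     + \<alpha>\<^sup>2 / (real n + \<beta>)"

end

theory Submission
  imports Defs "HOL-Analysis.Generalised_Binomial_Theorem"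
begin

text \<open>
  The weights \<open>W\<^sub>k\<close> form a probability distribution on the naturals: that of the sum of a negative
  binomial variable with mean \<open>n x\<close> and an independent Poisson variable with mean
  \<open>c = a x / (1 + x)\<close>, since the defining sum of \<open>p\<^sub>k(n, a)\<close> is exactly the convolution of the two
  (\<open>baskakov_W_eq_convolution\<close>). The sum therefore has mean \<open>n x + c\<close> and variance
  \<open>n x (1 + x) + c\<close>, and a short computation identifies \<open>\<gamma>\<close> as
  \<open>\<Sum>k. W\<^sub>k z\<^sub>k\<^sup>2\<close>, where \<open>z\<^sub>k\<close> is the distance between the node \<open>(k + \<alpha>) / (n + \<beta>)\<close> and \<open>x\<close>
  measured in units of \<open>\<delta>\<close> (\<open>stancu_second_moment\<close>).

  Cutting the segment between two points into pieces of length at most \<open>\<delta>\<close> gives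
  \<open>\<bar>f s - f t\<bar> \<le> (1 + \<bar>s - t\<bar> / \<delta>) \<omega>\<close> for a finite modulus \<open>\<omega>\<close>. Averaging this over the nodes
  bounds the error of the operator by \<open>(1 + \<Sum>k. W\<^sub>k z\<^sub>k) \<omega>\<close>, and a mean is at most the root of the
  mean square. If the modulus is infinite, the right-hand side is infinite because its first factor
  is positive.
\<close>

section \<open>Moments of weights on the naturals\<close>

text \<open>
  A weight on the naturals multiplied by its index is, for the negative binomial and Poisson weights,
  a multiple of the shift of a weight of the same family. The first two moments follow from the total
  mass and the mean of that other weight.
\<close>

lemma moments_of_shifted_weight:
  fixes p q :: "nat \<Rightarrow> real"
  assumes shift: "\<And>i. real (Suc i) * p (Suc i) = m * q i"
    and mass: "q sums 1"
  shows "(\<lambda>i. real i * p i) sums m"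
    and "(\<lambda>i. real i * q i) sums m' \<Longrightarrow> (\<lambda>i. (real i)\<^sup>2 * p i) sums (m * (m' + 1))"
proof -
  have "(\<lambda>i. real (Suc i) * p (Suc i)) sums (m * 1)"
    unfolding shift by (intro sums_mult mass)
  then show "(\<lambda>i. real i * p i) sums m"
    using sums_Suc_iff[of "\<lambda>i. real i * p i" m] by simp
next
  assume mean: "(\<lambda>i. real i * q i) sums m'"
  have "(real (Suc i))\<^sup>2 * p (Suc i) = m * (real i * q i + q i)" for i
  proof -
    have "(real (Suc i))\<^sup>2 * p (Suc i) = real (Suc i) * (real (Suc i) * p (Suc i))"
      by (simp add: power2_eq_square)
    also have "\<dots> = m * (real i * q i + q i)"
      unfolding shift by (simp add: algebra_simps)
    finally show ?thesis .
  qed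
  moreover have "(\<lambda>i. m * (real i * q i + q i)) sums (m * (m' + 1))"
    by (intro sums_mult sums_add mean mass)
  ultimately show "(\<lambda>i. (real i)\<^sup>2 * p i) sums (m * (m' + 1))"
    using sums_Suc_iff[of "\<lambda>i. (real i)\<^sup>2 * p i" "m * (m' + 1)"] by simp
qed

lemma sums_Cauchy_product_nonneg:
  fixes u v :: "nat \<Rightarrow> real"
  assumes "\<And>i. 0 \<le> u i" and "\<And>i. 0 \<le> v i" and "u sums A" and "v sums B"
  shows "(\<lambda>k. \<Sum>i\<le>k. u i * v (k - i)) sums (A * B)"
  using Cauchy_product_sums[of u v] assms by (simp add: sums_iff)

text \<open>
  The index of the convolution splits as \<open>k = i + (k - i)\<close>; expanding a power of it turns each moment
  of the convolution into a combination of Cauchy products of moments of the factors.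
\<close>

lemma moments_of_convolution:
  fixes u v :: "nat \<Rightarrow> real"
  assumes u: "\<And>i. 0 \<le> u i" and v: "\<And>i. 0 \<le> v i"
    and u0: "u sums A0" and u1: "(\<lambda>i. real i * u i) sums A1" and u2: "(\<lambda>i. (real i)\<^sup>2 * u i) sums A2"
    and v0: "v sums B0" and v1: "(\<lambda>i. real i * v i) sums B1" and v2: "(\<lambda>i. (real i)\<^sup>2 * v i) sums B2"
  shows "(\<lambda>k. \<Sum>i\<le>k. u i * v (k - i)) sums (A0 * B0)"
    and "(\<lambda>k. real k * (\<Sum>i\<le>k. u i * v (k - i))) sums (A1 * B0 + A0 * B1)"
    and "(\<lambda>k. (real k)\<^sup>2 * (\<Sum>i\<le>k. u i * v (k - i))) sums (A2 * B0 + 2 * (A1 * B1) + A0 * B2)"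
proof -
  note prod = sums_Cauchy_product_nonneg
  show "(\<lambda>k. \<Sum>i\<le>k. u i * v (k - i)) sums (A0 * B0)"
    by (intro prod u v u0 v0)
  have "(\<lambda>k. (\<Sum>i\<le>k. (real i * u i) * v (k - i)) + (\<Sum>i\<le>k. u i * (real (k - i) * v (k - i))))
        sums (A1 * B0 + A0 * B1)"
    by (intro sums_add prod[OF _ _ u1 v0] prod[OF _ _ u0 v1]) (simp_all add: u v)
  moreover have "(\<Sum>i\<le>k. (real i * u i) * v (k - i)) + (\<Sum>i\<le>k. u i * (real (k - i) * v (k - i)))
        = real k * (\<Sum>i\<le>k. u i * v (k - i))" for k
    unfolding sum_distrib_left sum.distrib[symmetric]
    by (rule sum.cong) (auto simp: of_nat_diff algebra_simps)
  ultimately show "(\<lambda>k. real k * (\<Sum>i\<le>k. u i * v (k - i))) sums (A1 * B0 + A0 * B1)"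
    by simp
  have "(\<lambda>k. (\<Sum>i\<le>k. ((real i)\<^sup>2 * u i) * v (k - i))
          + 2 * (\<Sum>i\<le>k. (real i * u i) * (real (k - i) * v (k - i)))
          + (\<Sum>i\<le>k. u i * ((real (k - i))\<^sup>2 * v (k - i))))
        sums (A2 * B0 + 2 * (A1 * B1) + A0 * B2)"
    by (intro sums_add sums_mult prod[OF _ _ u2 v0] prod[OF _ _ u1 v1] prod[OF _ _ u0 v2])
      (simp_all add: u v)
  moreover have "(\<Sum>i\<le>k. ((real i)\<^sup>2 * u i) * v (k - i))
          + 2 * (\<Sum>i\<le>k. (real i * u i) * (real (k - i) * v (k - i)))
          + (\<Sum>i\<le>k. u i * ((real (k - i))\<^sup>2 * v (k - i)))
        = (real k)\<^sup>2 * (\<Sum>i\<le>k. u i * v (k - i))" for k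
    unfolding sum_distrib_left sum.distrib[symmetric]
    by (rule sum.cong) (auto simp: of_nat_diff algebra_simps power2_eq_square)
  ultimately show "(\<lambda>k. (real k)\<^sup>2 * (\<Sum>i\<le>k. u i * v (k - i)))
      sums (A2 * B0 + 2 * (A1 * B1) + A0 * B2)"
    by simp
qed

section \<open>The negative binomial and Poisson factors\<close>

definition poisson_weight :: "real \<Rightarrow> nat \<Rightarrow> real" where
  "poisson_weight c j = exp (- c) * (c ^ j / fact j)"

text \<open>
  This is the distribution of the number of failures before the \<open>n\<close>-th success when each trial
  succeeds with probability \<open>1 / (1 + x)\<close>; this parametrisation makes the mean \<open>n x\<close>.
\<close>

definition neg_binomial_weight :: "nat \<Rightarrow> real \<Rightarrow> nat \<Rightarrow> real" where
  "neg_binomial_weight n x i = pochhammer (real n) i / fact i * (x ^ i / (1 + x) ^ (i + n))"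

lemma poisson_weight_nonneg: "0 \<le> c \<Longrightarrow> 0 \<le> poisson_weight c j"
  by (simp add: poisson_weight_def)

lemma poisson_weight_sums: "poisson_weight c sums 1"
proof -
  have "(\<lambda>j. exp (- c) * (c ^ j / fact j)) sums (exp (- c) * exp c)"
    using exp_converges[of c] by (intro sums_mult) (simp add: field_simps)
  then show ?thesis
    by (simp add: poisson_weight_def[abs_def] exp_minus)
qed

lemma poisson_weight_Suc: "real (Suc j) * poisson_weight c (Suc j) = c * poisson_weight c j"
  by (simp add: poisson_weight_def del: of_nat_Suc)

lemma neg_binomial_weight_nonneg: "0 \<le> x \<Longrightarrow> 0 \<le> neg_binomial_weight n x i"
  unfolding neg_binomial_weight_def pochhammer_prod
  by (intro mult_nonneg_nonneg divide_nonneg_nonneg prod_nonneg zero_le_power) auto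

lemma neg_binomial_weight_sums:
  assumes "0 \<le> x"
  shows "neg_binomial_weight n x sums 1"
proof -
  define y where "y = x / (1 + x)"
  have y: "0 \<le> y" "y < 1" and y1: "1 - y = inverse (1 + x)"
    using assms by (auto simp: y_def field_simps)
  (* Newton's binomial series for (1 - y) to the power -n *)
  have "(\<lambda>i. (- real n gchoose i) * (- y) ^ i) sums (1 + (- y)) powr (- real n)"
    using y by (intro gen_binomial_real) auto
  moreover have "(- real n gchoose i) * (- y) ^ i = pochhammer (real n) i / fact i * y ^ i" for i
  proof -
    have "(- real n gchoose i) * (- y) ^ i
        = ((-1) ^ i * (-1) ^ i) * (pochhammer (real n) i / fact i * y ^ i)"
      unfolding gbinomial_pochhammer power_minus[of y] by simp
    then show ?thesis
      by (simp add: power_mult_distrib[symmetric])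
  qed
  moreover have "(1 + (- y)) powr (- real n) = (1 + x) ^ n"
    using y y1 assms by (simp add: powr_minus powr_realpow power_inverse)
  ultimately have "(\<lambda>i. pochhammer (real n) i / fact i * y ^ i) sums (1 + x) ^ n"
    by simp
  from sums_divide[OF this, of "(1 + x) ^ n"] show ?thesis
    using assms
    by (simp add: neg_binomial_weight_def[abs_def] y_def power_divide power_add
        mult.assoc)
qed

text \<open>
  Multiplication by the index raises the parameter \<open>n\<close>, because
  \<open>(n)\<^bsub>i+1\<^esub> = n (n + 1)\<^sub>i\<close>. This is why the shift relation has to allow two different weights.
\<close>

lemma neg_binomial_weight_Suc:
  "real (Suc i) * neg_binomial_weight n x (Suc i) = real n * x * neg_binomial_weight (Suc n) x i"
  by (simp add: neg_binomial_weight_def pochhammer_rec add.commute del: of_nat_Suc)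
    (simp add: algebra_simps)

text \<open>
  Since \<open>(k choose i) / k! = 1 / (i! (k - i)!)\<close>, each term of \<open>p\<^sub>k(n, a) / k!\<close> splits into a factor in
  \<open>i\<close> and one in \<open>k - i\<close>; the powers of \<open>x\<close> and \<open>1 + x\<close> are distributed in the same way, and the
  exponential normalises the Poisson factor.
\<close>

lemma baskakov_W_eq_convolution:
  assumes "0 \<le> x"
  shows "baskakov_W n k a x
    = (\<Sum>i\<le>k. neg_binomial_weight n x i * poisson_weight (a * x / (1 + x)) (k - i))"
proof -
  let ?e = "exp (- (a * x / (1 + x)))"
  have "?e * ((real (k choose i) * pochhammer (real n) i * a ^ (k - i)) / fact k)
            * (x ^ k / (1 + x) ^ (k + n))
      = neg_binomial_weight n x i * poisson_weight (a * x / (1 + x)) (k - i)"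
    if "i \<le> k" for i
  proof -
    obtain j where k: "k = i + j"
      using \<open>i \<le> k\<close> le_Suc_ex by blast
    have coeff: "real (k choose i) / fact k = 1 / (fact i * fact j)"
      using binomial_fact[OF \<open>i \<le> k\<close>, where 'a = real] by (simp add: k)
    have "?e * ((real (k choose i) * pochhammer (real n) i * a ^ (k - i)) / fact k)
          * (x ^ k / (1 + x) ^ (k + n))
        = ?e * ((real (k choose i) / fact k) * pochhammer (real n) i * a ^ j)
          * (x ^ (i + j) / (1 + x) ^ (i + j + n))"
      by (simp add: k)
    also have "\<dots> = ?e * (1 / (fact i * fact j) * pochhammer (real n) i * a ^ j)
          * (x ^ (i + j) / (1 + x) ^ (i + j + n))"
      by (simp only: coeff)
    also have "\<dots> = neg_binomial_weight n x i * poisson_weight (a * x / (1 + x)) (k - i)"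
      by (simp add: k neg_binomial_weight_def poisson_weight_def power_add power_divide
          power_mult_distrib mult_ac)
    finally show ?thesis .
  qed
  then show ?thesis
    unfolding baskakov_W_def baskakov_p_def sum_divide_distrib sum_distrib_left sum_distrib_right
    by (simp add: atLeast0AtMost)
qed

lemma baskakov_W_nonneg:
  assumes "0 \<le> a" and "0 \<le> x"
  shows "0 \<le> baskakov_W n k a x"
  unfolding baskakov_W_eq_convolution[OF assms(2)] using assms
  by (intro sum_nonneg mult_nonneg_nonneg neg_binomial_weight_nonneg poisson_weight_nonneg) auto

lemma baskakov_W_moments:
  fixes a x :: real
  assumes a: "0 \<le> a" and x: "0 \<le> x"
  defines "c \<equiv> a * x / (1 + x)"
  shows "(\<lambda>k. baskakov_W n k a x) sums 1"
    and "(\<lambda>k. real k * baskakov_W n k a x) sums (real n * x + c)"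
    and "(\<lambda>k. (real k)\<^sup>2 * baskakov_W n k a x)
           sums (real n * x * (1 + x) + c + (real n * x + c)\<^sup>2)"
proof -
  have "0 \<le> c"
    using a x by (simp add: c_def)
  have conv: "baskakov_W n k a x = (\<Sum>i\<le>k. neg_binomial_weight n x i * poisson_weight c (k - i))" for k
    unfolding c_def by (rule baskakov_W_eq_convolution[OF x])
  note poisson_shift = moments_of_shifted_weight[where p = "poisson_weight c" and m = c
      and q = "poisson_weight c", OF poisson_weight_Suc poisson_weight_sums]
  have nb_mean: "(\<lambda>i. real i * neg_binomial_weight l x i) sums (real l * x)" for l
    by (rule moments_of_shifted_weight(1)[where q = "neg_binomial_weight (Suc l) x"])
      (rule neg_binomial_weight_Suc neg_binomial_weight_sums[OF x])+
  have nb_square: "(\<lambda>i. (real i)\<^sup>2 * neg_binomial_weight n x i)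
      sums (real n * x * (real (Suc n) * x + 1))"
    by (rule moments_of_shifted_weight(2)[where q = "neg_binomial_weight (Suc n) x"])
      (rule neg_binomial_weight_Suc neg_binomial_weight_sums[OF x] nb_mean)+
  note conv_moments = moments_of_convolution[where u = "neg_binomial_weight n x"
      and v = "poisson_weight c", OF neg_binomial_weight_nonneg[OF x]
      poisson_weight_nonneg[OF \<open>0 \<le> c\<close>] neg_binomial_weight_sums[OF x] nb_mean nb_square
      poisson_weight_sums poisson_shift(1)
      poisson_shift(2)[OF poisson_shift(1)], folded conv]
  show "(\<lambda>k. baskakov_W n k a x) sums 1"
    using conv_moments(1) by simp
  show "(\<lambda>k. real k * baskakov_W n k a x) sums (real n * x + c)"
    using conv_moments(2) by simp
  show "(\<lambda>k. (real k)\<^sup>2 * baskakov_W n k a x)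
      sums (real n * x * (1 + x) + c + (real n * x + c)\<^sup>2)"
    using conv_moments(3) by (simp add: algebra_simps power2_eq_square)
qed

text \<open>
  Expanding the square reduces the claim to the three moments. The factor \<open>1 / \<delta>\<^sup>2 = n + \<beta>\<close> cancels
  one of the two powers of \<open>n + \<beta>\<close> in the squared distance, which leaves the single denominator that
  \<open>\<gamma>\<close> has throughout.
\<close>

lemma stancu_second_moment:
  assumes a: "0 \<le> a" and x: "0 \<le> x" and N: "0 < real n + \<beta>"
  shows "(\<lambda>k. baskakov_W n k a x
            * (\<bar>(real k + \<alpha>) / (real n + \<beta>) - x\<bar> / stancu_delta n \<beta>)\<^sup>2)
         sums stancu_gamma n a \<alpha> \<beta> x"
proof -
  define N where "N = real n + \<beta>"
  define c where "c = a * x / (1 + x)"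
  define d where "d = \<alpha> - N * x"
  have "0 < N"
    using N by (simp add: N_def)
  have delta: "(stancu_delta n \<beta>)\<^sup>2 = 1 / N"
    using \<open>0 < N\<close>
    by (simp add: stancu_delta_def N_def[symmetric] power2_eq_square powr_add[symmetric]
        powr_minus_divide del: powr_minus)
  have "baskakov_W n k a x * (\<bar>(real k + \<alpha>) / N - x\<bar> / stancu_delta n \<beta>)\<^sup>2
      = ((real k)\<^sup>2 * baskakov_W n k a x + 2 * d * (real k * baskakov_W n k a x)
          + d\<^sup>2 * baskakov_W n k a x) / N" for k
  proof -
    have "(real k + \<alpha>) / N - x = (real k + d) / N"
      using \<open>0 < N\<close> by (simp add: d_def field_simps)
    then have "(\<bar>(real k + \<alpha>) / N - x\<bar> / stancu_delta n \<beta>)\<^sup>2 = ((real k + d) / N)\<^sup>2 / (1 / N)"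
      by (simp only: power_divide power2_abs delta)
    also have "\<dots> = (real k + d)\<^sup>2 / N"
      using \<open>0 < N\<close> by (simp add: power2_eq_square)
    finally have dist: "(\<bar>(real k + \<alpha>) / N - x\<bar> / stancu_delta n \<beta>)\<^sup>2 = (real k + d)\<^sup>2 / N" .
    have "baskakov_W n k a x * (real k + d)\<^sup>2
        = (real k)\<^sup>2 * baskakov_W n k a x + 2 * d * (real k * baskakov_W n k a x)
          + d\<^sup>2 * baskakov_W n k a x"
      by (simp add: power2_eq_square algebra_simps)
    then show ?thesis
      unfolding dist times_divide_eq_right by (rule arg_cong)
  qed
  moreover have "(\<lambda>k. ((real k)\<^sup>2 * baskakov_W n k a x + 2 * d * (real k * baskakov_W n k a x)
          + d\<^sup>2 * baskakov_W n k a x) / N)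
      sums (((real n * x * (1 + x) + c + (real n * x + c)\<^sup>2) + 2 * d * (real n * x + c)
          + d\<^sup>2 * 1) / N)"
    unfolding c_def by (intro sums_divide sums_add sums_mult baskakov_W_moments a x)
  moreover have "((real n * x * (1 + x) + c + (real n * x + c)\<^sup>2) + 2 * d * (real n * x + c)
          + d\<^sup>2 * 1) / N = stancu_gamma n a \<alpha> \<beta> x"
  proof -
    have c: "x\<^sup>2 / (1 + x)\<^sup>2 * a\<^sup>2 = c\<^sup>2" "x\<^sup>2 / (1 + x) * a = c * x" "x / (1 + x) * a = c"
      by (simp_all add: c_def power2_eq_square)
    have "stancu_gamma n a \<alpha> \<beta> x
        = ((real n + \<beta>\<^sup>2) * x\<^sup>2 + (real n - 2 * \<alpha> * \<beta>) * x + x\<^sup>2 / (1 + x)\<^sup>2 * a\<^sup>2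
            - 2 * \<beta> * (x\<^sup>2 / (1 + x) * a) + (1 + 2 * \<alpha>) * (x / (1 + x) * a) + \<alpha>\<^sup>2) / N"
      unfolding stancu_gamma_def N_def[symmetric]
      by (simp only: add_divide_distrib diff_divide_distrib ring_distribs times_divide_eq_left
          times_divide_eq_right divide_divide_eq_left mult_1_left mult_1_right mult_ac)
    then have "stancu_gamma n a \<alpha> \<beta> x
        = ((real n + \<beta>\<^sup>2) * x\<^sup>2 + (real n - 2 * \<alpha> * \<beta>) * x + c\<^sup>2 - 2 * \<beta> * (c * x)
            + (1 + 2 * \<alpha>) * c + \<alpha>\<^sup>2) / N"
      unfolding c .
    moreover have "(real n * x * (1 + x) + c + (real n * x + c)\<^sup>2) + 2 * d * (real n * x + c) + d\<^sup>2
        = (real n + \<beta>\<^sup>2) * x\<^sup>2 + (real n - 2 * \<alpha> * \<beta>) * x + c\<^sup>2 - 2 * \<beta> * (c * x)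
            + (1 + 2 * \<alpha>) * c + \<alpha>\<^sup>2"
      by (simp add: d_def N_def power2_eq_square algebra_simps)
    ultimately show ?thesis
      by simp
  qed
  ultimately show ?thesis
    by (simp add: N_def)
qed

section \<open>The modulus of continuity\<close>

lemma modulus_of_continuity_upper:
  assumes "0 \<le> s" "0 \<le> t" "\<bar>s - t\<bar> \<le> \<delta>"
  shows "ereal \<bar>f s - f t\<bar> \<le> modulus_of_continuity f \<delta>"
  unfolding modulus_of_continuity_def using assms by (intro Sup_upper) blast

lemma modulus_of_continuity_nonneg:
  assumes "0 \<le> \<delta>"
  shows "0 \<le> modulus_of_continuity f \<delta>"
  using modulus_of_continuity_upper[of 0 0 \<delta> f] assms by (simp add: zero_ereal_def)

lemma variation_le_steps:
  fixes f :: "real \<Rightarrow> real"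
  assumes "0 \<le> \<delta>" and w: "modulus_of_continuity f \<delta> = ereal w"
  shows "0 \<le> s \<Longrightarrow> s \<le> t \<Longrightarrow> t - s \<le> real m * \<delta> \<Longrightarrow> \<bar>f s - f t\<bar> \<le> real m * w"
proof (induction m arbitrary: t)
  case 0
  then show ?case by simp
next
  case (Suc m)
  define r where "r = max s (t - \<delta>)"
  have r: "0 \<le> r" "s \<le> r" "r \<le> t" "t - r \<le> \<delta>" "r - s \<le> real m * \<delta>"
    using Suc.prems \<open>0 \<le> \<delta>\<close> by (auto simp: r_def algebra_simps)
  have "\<bar>f s - f r\<bar> \<le> real m * w"
    using Suc.IH[of r] Suc.prems r by simp
  moreover have "\<bar>f r - f t\<bar> \<le> w"
    using modulus_of_continuity_upper[of r t \<delta> f] r by (simp add: w)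
  ultimately show ?case
    by (simp add: algebra_simps)
qed

text \<open>
  The number of steps is the ceiling of \<open>\<bar>s - t\<bar> / \<delta>\<close>, which exceeds that quotient by at most one;
  this is the origin of the summand \<open>1\<close> in the first factor of the final bound.
\<close>

lemma variation_le_modulus:
  fixes f :: "real \<Rightarrow> real"
  assumes "0 < \<delta>" and w: "modulus_of_continuity f \<delta> = ereal w" and st: "0 \<le> s" "0 \<le> t"
  shows "\<bar>f s - f t\<bar> \<le> (1 + \<bar>s - t\<bar> / \<delta>) * w"
proof -
  define m where "m = nat \<lceil>\<bar>s - t\<bar> / \<delta>\<rceil>"
  have "0 \<le> w"
    using modulus_of_continuity_nonneg[of \<delta> f] \<open>0 < \<delta>\<close> w by simp
  have ge: "\<bar>s - t\<bar> / \<delta> \<le> real m"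
    unfolding m_def by (rule real_nat_ceiling_ge)
  have "0 \<le> \<lceil>\<bar>s - t\<bar> / \<delta>\<rceil>"
    using \<open>0 < \<delta>\<close> by (simp only: zero_le_ceiling) (rule order_less_le_trans[of _ 0], auto)
  then have le: "real m \<le> 1 + \<bar>s - t\<bar> / \<delta>"
    using of_int_ceiling_le_add_one[of "\<bar>s - t\<bar> / \<delta>"]
    by (simp only: m_def of_nat_nat add.commute)
  have len: "\<bar>s - t\<bar> \<le> real m * \<delta>"
    using ge \<open>0 < \<delta>\<close> by (simp only: pos_divide_le_eq)
  note steps = variation_le_steps[OF less_imp_le[OF \<open>0 < \<delta>\<close>] w]
  have "\<bar>f s - f t\<bar> \<le> real m * w"
  proof (cases "s \<le> t")
    case True
    have "t - s \<le> real m * \<delta>"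
      using len by linarith
    then show ?thesis
      by (rule steps[OF st(1) True])
  next
    case False
    then have "t \<le> s" and "s - t \<le> real m * \<delta>"
      using len by linarith+
    then have "\<bar>f t - f s\<bar> \<le> real m * w"
      by (rule steps[OF st(2)])
    then show ?thesis
      by (simp only: abs_minus_commute[of "f s"])
  qed
  also have "\<dots> \<le> (1 + \<bar>s - t\<bar> / \<delta>) * w"
    using le \<open>0 \<le> w\<close> by (rule mult_right_mono)
  finally show ?thesis .
qed

section \<open>Averaging over the nodes\<close>

lemma mean_le_sqrt_mean_square:
  fixes p z :: "nat \<Rightarrow> real"
  assumes p: "\<And>k. 0 \<le> p k" and p1: "p sums 1" and z: "\<And>k. 0 \<le> z k"
    and z2: "(\<lambda>k. p k * (z k)\<^sup>2) sums g"
  shows "summable (\<lambda>k. p k * z k)" and "(\<Sum>k. p k * z k) \<le> sqrt g"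
proof -
  (* this makes the first moment converge by comparison with mass and second moment *)
  have le: "z k \<le> 1 + (z k)\<^sup>2" for k
    using sum_power2_ge_zero[of "z k - 1" "z k"] z[of k] by (simp add: power2_eq_square algebra_simps)
  have "summable (\<lambda>k. p k + p k * (z k)\<^sup>2)"
    using p1 z2 by (intro summable_add) (auto simp: sums_iff)
  then show "summable (\<lambda>k. p k * z k)"
  proof (rule summable_comparison_test')
    show "norm (p k * z k) \<le> p k + p k * (z k)\<^sup>2" for k
      using mult_left_mono[OF le[of k] p[of k]] p[of k] z[of k] by (simp add: algebra_simps)
  qed
  then have mean: "(\<lambda>k. p k * z k) sums (\<Sum>k. p k * z k)"
    by (rule summable_sums)
  define e where "e = (\<Sum>k. p k * z k)"
  (* the variance is nonnegative *)
  have variance: "(\<lambda>k. p k * (z k)\<^sup>2 - 2 * e * (p k * z k) + e\<^sup>2 * p k) sums (g - 2 * e * e + e\<^sup>2 * 1)"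
    unfolding e_def by (intro sums_add sums_diff sums_mult mean p1 z2)
  have "0 \<le> p k * (z k)\<^sup>2 - 2 * e * (p k * z k) + e\<^sup>2 * p k" for k
  proof -
    have "p k * (z k)\<^sup>2 - 2 * e * (p k * z k) + e\<^sup>2 * p k = p k * (z k - e)\<^sup>2"
      by (simp add: power2_eq_square algebra_simps)
    then show ?thesis
      using p[of k] by simp
  qed
  then have "0 \<le> g - 2 * e * e + e\<^sup>2 * 1"
    by (rule sums_le[OF _ sums_zero variance])
  then show "(\<Sum>k. p k * z k) \<le> sqrt g"
    by (intro real_le_rsqrt) (simp add: e_def[symmetric] power2_eq_square)
qed

text \<open>
  The termwise bound does double duty: it also makes the series of the averages of \<open>h\<close> converge
  absolutely, so that its sum is a genuine limit and \<open>y\<close>, being the average of a constant, can be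
  subtracted termwise.
\<close>

lemma weighted_average_error:
  fixes p z h :: "nat \<Rightarrow> real"
  assumes p: "\<And>k. 0 \<le> p k" and p1: "p sums 1" and pz: "summable (\<lambda>k. p k * z k)"
    and h: "\<And>k. \<bar>h k - y\<bar> \<le> (1 + z k) * w"
  shows "\<bar>(\<Sum>k. p k * h k) - y\<bar> \<le> (1 + (\<Sum>k. p k * z k)) * w"
proof -
  have bound: "(\<lambda>k. (p k + p k * z k) * w) sums ((1 + (\<Sum>k. p k * z k)) * w)"
    by (intro sums_mult2 sums_add p1 summable_sums pz)
  have le: "norm (p k * (h k - y)) \<le> (p k + p k * z k) * w" for k
  proof -
    have "norm (p k * (h k - y)) = p k * \<bar>h k - y\<bar>"
      using p[of k] by (simp add: abs_mult)
    also have "\<dots> \<le> p k * ((1 + z k) * w)"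
      by (intro mult_left_mono h p)
    finally show ?thesis
      by (simp add: algebra_simps)
  qed
  have dev: "summable (\<lambda>k. norm (p k * (h k - y)))"
    using le by (intro summable_comparison_test'[OF sums_summable[OF bound]]) simp
  have "(\<lambda>k. p k * (h k - y) + p k * y) sums ((\<Sum>k. p k * (h k - y)) + 1 * y)"
    by (intro sums_add sums_mult2 p1 summable_sums summable_norm_cancel[OF dev])
  then have "(\<Sum>k. p k * h k) = (\<Sum>k. p k * (h k - y)) + y"
    by (simp add: sums_iff algebra_simps)
  then have "\<bar>(\<Sum>k. p k * h k) - y\<bar> \<le> (\<Sum>k. norm (p k * (h k - y)))"
    using summable_norm[OF dev] by simp
  also have "\<dots> \<le> (1 + (\<Sum>k. p k * z k)) * w"
    using sums_le[OF le summable_sums[OF dev] bound] .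
  finally show ?thesis .
qed

theorem theorem3p1:
  fixes a \<alpha> \<beta> x :: real and n :: nat and f :: "real \<Rightarrow> real"
  assumes "a \<ge> 0"
    and "0 \<le> \<alpha>" and "\<alpha> \<le> \<beta>"
    and "n \<ge> 1"
    and "continuous_on {0..} f"
    and "x \<in> {0..}"
  shows "ereal \<bar>stancu_baskakov n a \<alpha> \<beta> f x - f x\<bar>
           \<le> ereal (1 + sqrt (stancu_gamma n a \<alpha> \<beta> x)) * modulus_of_continuity f (stancu_delta n \<beta>)"
proof -
  define \<delta> where "\<delta> = stancu_delta n \<beta>"
  define t where "t k = (real k + \<alpha>) / (real n + \<beta>)" for k :: nat
  define z where "z k = \<bar>t k - x\<bar> / \<delta>" for k
  define p where "p k = baskakov_W n k a x" for k
  define g where "g = stancu_gamma n a \<alpha> \<beta> x"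
  have x: "0 \<le> x" and N: "0 < real n + \<beta>"
    using assms by auto
  have "0 < \<delta>"
    using N by (simp add: \<delta>_def stancu_delta_def)
  have t: "0 \<le> t k" for k
    using assms N by (simp add: t_def)
  have z: "0 \<le> z k" for k
    using \<open>0 < \<delta>\<close> by (simp add: z_def)
  have p: "0 \<le> p k" for k
    using baskakov_W_nonneg[OF \<open>a \<ge> 0\<close> x] by (simp add: p_def)
  have p1: "p sums 1"
    using baskakov_W_moments(1)[OF \<open>a \<ge> 0\<close> x] by (simp add: p_def[abs_def])
  have z2: "(\<lambda>k. p k * (z k)\<^sup>2) sums g"
    using stancu_second_moment[OF \<open>a \<ge> 0\<close> x N]
    by (simp add: p_def z_def t_def g_def \<delta>_def)
  note mean = mean_le_sqrt_mean_square[OF p p1 z z2]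
  show ?thesis
  proof (cases "modulus_of_continuity f \<delta>")
    case (real w)
    have "0 \<le> w"
      using modulus_of_continuity_nonneg[of \<delta> f] \<open>0 < \<delta>\<close> real by simp
    have "\<bar>stancu_baskakov n a \<alpha> \<beta> f x - f x\<bar> = \<bar>(\<Sum>k. p k * f (t k)) - f x\<bar>"
      by (simp add: stancu_baskakov_def p_def t_def)
    also have "\<dots> \<le> (1 + (\<Sum>k. p k * z k)) * w"
      unfolding z_def
      by (intro weighted_average_error p p1 variation_le_modulus \<open>0 < \<delta>\<close> real t x
          mean(1)[unfolded z_def])
    also have "\<dots> \<le> (1 + sqrt g) * w"
      using mean(2) \<open>0 \<le> w\<close> by (intro mult_right_mono) auto
    finally show ?thesis
      using real by (simp add: \<delta>_def g_def)
  next
    case PInf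
    have "0 \<le> g"
      using p by (intro sums_le[OF _ sums_zero z2]) simp
    then have "0 < 1 + sqrt g"
      by (simp add: add_pos_nonneg)
    then show ?thesis
      using PInf by (simp add: \<delta>_def g_def)
  next
    case MInf
    then show ?thesis
      using modulus_of_continuity_nonneg[of \<delta> f] \<open>0 < \<delta>\<close> by simp
  qed
qed

end
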